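(* Let $g:\mathbb{Z}^n \to \mathbb{R}\cup\{+\infty\}$ be a semi-strictly quasi L$^{\natural}$-convex function, and suppose that the initial vector $p^\circ\in\mathrm{dom}\, g$ in the algorithm SteepestDescentUp is a lower bound of some minimizer of $g$ (i.e., $p^\circ\le p^*$ component-wise for some $p^*\in\arg\min g$). Then the algorithm outputs a minimizer of $g$ and terminates exactly in $\hat\mu(p^\circ)+1$ iterations.
   Context: Notation: $n$ is a positive integer, $N=\{1,\dots,n\}$; for $X\subseteq N$, $e_X\in\{0,1\}^n$ is the characteristic vector of $X$ ($e_X(i)=1$ if $i\in X$, and $e_X(i)=0$ otherwise); $\mathbf{1}=(1,\dots,1)$; $p\wedge q$ and $p\vee q$ denote the component-wise minimum and maximum of $p,q\in\mathbb{Z}^n$; $\mathrm{dom}\, g=\{p\in\mathbb{Z}^n\mid g(p)<+\infty\}$; $\arg\min g$ is the set of minimizers of $g$ (vectors in $\mathrm{dom}\, g$ attaining the minimum of $g$). Definition. A function $g:\mathbb{Z}^n\to\mathbb{R}\cup\{+\infty\}$ is semi-strictly quasi L$^{\natural}$-convex if for every $p,q\in\mathrm{dom}\, g$ and every nonnegative integer $\lambda$, both (I) and (II) hold: (I) at least one of the following holds: (a) $g(p)>g((p-\lambda\mathbf{1})\vee q)$; (b) $g(q)>g(p\wedge(q+\lambda\mathbf{1}))$; (c) $g(p)=g((p-\lambda\mathbf{1})\vee q)$ and $g(q)=g(p\wedge(q+\lambda\mathbf{1}))$. (II) at least one of the following holds: (a) $g(q)>g((p-\lambda\mathbf{1})\vee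 q)$; (b) $g(p)>g(p\wedge(q+\lambda\mathbf{1}))$; (c) $g(q)=g((p-\lambda\mathbf{1})\vee q)$ and $g(p)=g(p\wedge(q+\lambda\mathbf{1}))$. For $p\in\mathbb{Z}^n$ that is a lower bound of some minimizer of $g$, $$\hat\mu(p)=\min\{\|p^*-p\|_\infty \mid p^*\in\arg\min g,\ p^*\ge p\},$$ where $\|q\|_\infty=\max_{i\in N}|q(i)|$ and $\ge$ is component-wise. Algorithm SteepestDescentUp with initial vector $p^\circ$: Step 0: Set $p:=p^\circ$. Step 1: Find $X\subseteq N$ that minimizes $g(p+e_X)$ (ties are broken arbitrarily). Step 2: If $g(p+e_X)=g(p)$, then output $p$ and stop. Step 3: Set $p:=p+e_X$ and go to Step 1. The number of iterations is the number of times Step 1 is executed (including the last execution, after which the algorithm stops in Step 2). *)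

theory Defs
  imports
    Complex_Main
    "HOL-Library.Extended_Real"
    "HOL-Library.Function_Algebras"
    "HOL-Library.Indicator_Function"
begin

text \<open>
  Integer vectors are functions from a finite index type to the integers, with the pointwise
  order, lattice operations (\<open>inf\<close>, \<open>sup\<close>) and addition. Functions with values in the reals
  extended by plus infinity are \<open>ereal\<close>-valued functions that avoid \<open>-\<infinity>\<close>; the theorem carries
  this as an explicit assumption.
\<close>

definition edom :: "(('n::finite \<Rightarrow> int) \<Rightarrow> ereal) \<Rightarrow> ('n \<Rightarrow> int) set" where
  "edom g = {p. g p < \<infinity>}"

definition minimizers :: "(('n::finite \<Rightarrow> int) \<Rightarrow> ereal) \<Rightarrow> ('n \<Rightarrow> int) set" where
  "minimizers g = {p \<in> edom g. \<forall>q. g p \<le> g q}"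

definition ssq_Lnat_convex :: "(('n::finite \<Rightarrow> int) \<Rightarrow> ereal) \<Rightarrow> bool" where
  "ssq_Lnat_convex g \<longleftrightarrow>
    (\<forall>p\<in>edom g. \<forall>q\<in>edom g. \<forall>l::nat.
      let u = sup (p - (\<lambda>_. int l)) q;
          v = inf p (q + (\<lambda>_. int l))
      in (g p > g u \<or> g q > g v \<or> (g p = g u \<and> g q = g v)) \<and>
         (g q > g u \<or> g p > g v \<or> (g q = g u \<and> g p = g v)))"

definition linf_norm :: "('n::finite \<Rightarrow> int) \<Rightarrow> int" where
  "linf_norm q = Max (range (\<lambda>i. \<bar>q i\<bar>))"

text \<open>The set of minimizers may be infinite, so the minimum is taken with \<open>LEAST\<close>, not \<open>Min\<close>.
  It is meaningful only if \<open>p\<close> is a lower bound of some minimizer.\<close>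

definition mu_hat :: "(('n::finite \<Rightarrow> int) \<Rightarrow> ereal) \<Rightarrow> ('n \<Rightarrow> int) \<Rightarrow> nat" where
  "mu_hat g p = (LEAST m. \<exists>p'\<in>minimizers g. p \<le> p' \<and> int m = linf_norm (p' - p))"

text \<open>
  Small-step semantics of the algorithm. The counter is the number of executions of Step 1 so far;
  one transition performs Steps 1, 2 and (unless the algorithm stops) 3. Arbitrary tie-breaking
  is the nondeterminism in the choice of \<open>X\<close>. The vector \<open>indicator X\<close> is the characteristic
  vector of \<open>X\<close>.
\<close>

datatype 'n sdu_state =
    Running nat "'n \<Rightarrow> int"
  | Halted nat "'n \<Rightarrow> int"

inductive sdu_step ::
    "(('n::finite \<Rightarrow> int) \<Rightarrow> ereal) \<Rightarrow> 'n sdu_state \<Rightarrow> 'n sdu_state \<Rightarrow> bool"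
  for g where
    stop: "\<lbrakk>is_arg_min (\<lambda>X. g (p + indicator X)) (\<lambda>_. True) X; g (p + indicator X) = g p\<rbrakk>
      \<Longrightarrow> sdu_step g (Running k p) (Halted (Suc k) p)"
  | move: "\<lbrakk>is_arg_min (\<lambda>X. g (p + indicator X)) (\<lambda>_. True) X; g (p + indicator X) \<noteq> g p\<rbrakk>
      \<Longrightarrow> sdu_step g (Running k p) (Running (Suc k) (p + indicator X))"

end

theory Submission
  imports Defs
begin

text \<open>
  The theorem follows from a statement about a single iteration: if \<open>p\<close> lies below a minimizer but
  is not one, then every steepest descent step \<open>X\<close> strictly decreases \<open>g\<close>, keeps
  \<open>p + indicator X\<close> below a minimizer, and lowers \<open>mu_hat\<close> by exactly one
  (\<open>steepest_step_decreases\<close> and \<open>mu_hat_steepest_step\<close>). Hence the number of executed iterations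
  plus \<open>mu_hat\<close> of the current vector is invariant, the run cannot be infinite, and the last
  execution of Step 1, which only detects optimality, contributes the additional one.

  Let \<open>m = mu_hat g p > 0\<close> and let \<open>p'\<close> be a minimizer with \<open>p \<le> p' \<le> p + m\<close>. Exchanging \<open>p'\<close> and
  \<open>p\<close> with shift \<open>m - 1\<close> replaces \<open>p'\<close> by a vector too close to \<open>p\<close> to be a minimizer and \<open>p\<close> by
  some \<open>p + indicator A\<close>; semi-strictness forces \<open>g\<close> to decrease at the latter. For the distance,
  put \<open>q = p + indicator X\<close>. Two further exchanges, in each of which \<open>q\<close> becomes another vector of
  the form \<open>p + indicator Y\<close> and therefore cannot improve, move the minimizer: the first, with
  shift zero, makes it at least \<open>q\<close>, and the second, with shift \<open>m - 1\<close>, makes it at most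
  \<open>q + (m - 1)\<close>. In the other direction, a minimizer close to \<open>q\<close> is at most one unit farther
  from \<open>p\<close>.
\<close>

section \<open>Exchange with a minimizer\<close>

lemma minimizer_le: "p \<in> minimizers g \<Longrightarrow> g p \<le> g q"
  by (simp add: minimizers_def)

lemma minimizer_in_edom: "p \<in> minimizers g \<Longrightarrow> p \<in> edom g"
  by (simp add: minimizers_def)

lemma minimizer_eq: "\<lbrakk>p \<in> minimizers g; g q = g p\<rbrakk> \<Longrightarrow> q \<in> minimizers g"
  by (simp add: minimizers_def edom_def)

text \<open>
  A minimizer cannot be improved, so the alternatives in the definition that decrease \<open>g\<close> from the
  minimizer drop out. If the partner \<open>q\<close> is not improved by its replacement either, only the
  equality alternative is left. The two versions differ in which of the two new vectors replaces
  which old one; they come from parts (I) and (II) of the definition.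
\<close>

lemma exchange_sup_minimizer:
  assumes "ssq_Lnat_convex g" "p' \<in> minimizers g" "q \<in> edom g"
    and "g q \<le> g (inf p' (q + (\<lambda>_. int l)))"
  shows "sup (p' - (\<lambda>_. int l)) q \<in> minimizers g"
proof -
  let ?u = "sup (p' - (\<lambda>_. int l)) q" and ?v = "inf p' (q + (\<lambda>_. int l))"
  have "g p' > g ?u \<or> g q > g ?v \<or> (g p' = g ?u \<and> g q = g ?v)"
    using assms(1,3) minimizer_in_edom[OF assms(2)]
    unfolding ssq_Lnat_convex_def Let_def by blast
  then have "g ?u = g p'"
    using minimizer_le[OF assms(2), of ?u] assms(4) by (metis leD)
  then show ?thesis by (rule minimizer_eq[OF assms(2)])
qed

lemma exchange_inf_minimizer:
  assumes "ssq_Lnat_convex g" "p' \<in> minimizers g" "q \<in> edom g"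
    and "g q \<le> g (sup (p' - (\<lambda>_. int l)) q)"
  shows "inf p' (q + (\<lambda>_. int l)) \<in> minimizers g"
proof -
  let ?u = "sup (p' - (\<lambda>_. int l)) q" and ?v = "inf p' (q + (\<lambda>_. int l))"
  have "g q > g ?u \<or> g p' > g ?v \<or> (g q = g ?u \<and> g p' = g ?v)"
    using assms(1,3) minimizer_in_edom[OF assms(2)]
    unfolding ssq_Lnat_convex_def Let_def by blast
  then have "g ?v = g p'"
    using minimizer_le[OF assms(2), of ?v] assms(4) by (metis leD)
  then show ?thesis by (rule minimizer_eq[OF assms(2)])
qed

section \<open>Distance to the nearest minimizer above\<close>

text \<open>
  Distances only enter through order bounds: the norm condition in \<open>mu_hat\<close> is equivalent, for the
  least value, to lying in a box above \<open>p\<close>.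
\<close>

lemma linf_norm_le_iff:
  assumes "p \<le> p'"
  shows "linf_norm (p' - p) \<le> int m \<longleftrightarrow> p' \<le> p + (\<lambda>_. int m)"
proof -
  have "\<bar>p' i - p i\<bar> \<le> int m \<longleftrightarrow> p' i \<le> p i + int m" for i
    using le_funD[OF assms, of i] by linarith
  then show ?thesis by (simp add: linf_norm_def le_fun_def)
qed

lemma linf_norm_nonneg: "0 \<le> linf_norm q"
proof -
  have "\<bar>q undefined\<bar> \<le> linf_norm q" by (simp add: linf_norm_def)
  then show ?thesis by linarith
qed

lemma mu_hat_le:
  assumes "p' \<in> minimizers g" "p \<le> p'" "p' \<le> p + (\<lambda>_. int m)"
  shows "mu_hat g p \<le> m"
proof -
  have "int (nat (linf_norm (p' - p))) = linf_norm (p' - p)"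
    by (simp add: linf_norm_nonneg)
  then have "mu_hat g p \<le> nat (linf_norm (p' - p))"
    unfolding mu_hat_def using assms(1,2) by (intro Least_le) auto
  also have "\<dots> \<le> m"
    using linf_norm_le_iff[OF assms(2), of m] assms(3) by simp
  finally show ?thesis .
qed

lemma mu_hat_attained:
  assumes "\<exists>p'\<in>minimizers g. p \<le> p'"
  obtains p' where "p' \<in> minimizers g" "p \<le> p'" "p' \<le> p + (\<lambda>_. int (mu_hat g p))"
proof -
  obtain p1 where "p1 \<in> minimizers g" "p \<le> p1" using assms by blast
  then have "\<exists>p'\<in>minimizers g. p \<le> p' \<and> int (nat (linf_norm (p1 - p))) = linf_norm (p' - p)"
    by (auto simp: linf_norm_nonneg)
  then have "\<exists>p'\<in>minimizers g. p \<le> p' \<and> int (mu_hat g p) = linf_norm (p' - p)"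
    unfolding mu_hat_def by (rule LeastI)
  then obtain p' where "p' \<in> minimizers g" "p \<le> p'" "int (mu_hat g p) = linf_norm (p' - p)"
    by blast
  then show thesis using linf_norm_le_iff[of p p' "mu_hat g p"] that by simp
qed

lemma mu_hat_minimizer:
  assumes "p \<in> minimizers g"
  shows "mu_hat g p = 0"
  using mu_hat_le[OF assms, of p 0] by (simp add: le_fun_def)

lemma mu_hat_pos:
  assumes "\<exists>p'\<in>minimizers g. p \<le> p'" "p \<notin> minimizers g"
  shows "0 < mu_hat g p"
proof (rule ccontr)
  assume "\<not> 0 < mu_hat g p"
  moreover obtain p' where "p' \<in> minimizers g" "p \<le> p'" "p' \<le> p + (\<lambda>_. int (mu_hat g p))"
    using mu_hat_attained[OF assms(1)] .
  ultimately have "p' = p" by (simp add: le_fun_def fun_eq_iff order_antisym)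
  then show False using \<open>p' \<in> minimizers g\<close> assms(2) by simp
qed

section \<open>One iteration\<close>

text \<open>
  The unit box above \<open>p\<close> is exactly the set of vectors over which Step 1 minimizes; the exchanges
  below only need to be seen to stay in this box.
\<close>

lemma unit_box_indicator:
  fixes p v :: "'n \<Rightarrow> int"
  assumes "\<And>i. p i \<le> v i" "\<And>i. v i \<le> p i + 1"
  shows "v = p + indicator {i. v i \<noteq> p i}"
proof
  fix i show "v i = (p + indicator {i. v i \<noteq> p i}) i"
    using assms(1)[of i] assms(2)[of i] by (auto simp: indicator_def)
qed

lemma arg_min_le_unit_box:
  fixes p v :: "'n \<Rightarrow> int" and g :: "('n \<Rightarrow> int) \<Rightarrow> ereal"
  assumes "is_arg_min (\<lambda>X. g (p + indicator X)) (\<lambda>_. True) X"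
    and "\<And>i. p i \<le> v i" "\<And>i. v i \<le> p i + 1"
  shows "g (p + indicator X) \<le> g v"
proof -
  have "g (p + indicator X) \<le> g (p + indicator {i. v i \<noteq> p i})"
    using assms(1) unfolding is_arg_min_linorder by blast
  also have "p + indicator {i. v i \<noteq> p i} = v"
    by (rule unit_box_indicator[OF assms(2,3), symmetric])
  finally show ?thesis .
qed

text \<open>
  The exchange moves a nearest minimizer \<open>p'\<close> to within \<open>mu_hat g p - 1\<close> of \<open>p\<close>, where no
  minimizer exists; so the hypothesis of \<open>exchange_inf_minimizer\<close> must fail, that is, \<open>g\<close>
  decreases at the vector that replaces \<open>p\<close>.
\<close>

lemma steepest_step_decreases:
  fixes g :: "('n::finite \<Rightarrow> int) \<Rightarrow> ereal"
  assumes g: "ssq_Lnat_convex g" and p: "p \<in> edom g" and lb: "\<exists>p'\<in>minimizers g. p \<le> p'"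
    and nonmin: "p \<notin> minimizers g"
    and X: "is_arg_min (\<lambda>X. g (p + indicator X)) (\<lambda>_. True) X"
  shows "g (p + indicator X) < g p"
proof -
  obtain l where l: "mu_hat g p = Suc l"
    using mu_hat_pos[OF lb nonmin] gr0_implies_Suc by blast
  obtain p' where p': "p' \<in> minimizers g" "p \<le> p'" "p' \<le> p + (\<lambda>_. int (Suc l))"
    using mu_hat_attained[OF lb] unfolding l .
  have box: "p i \<le> p' i" "p' i \<le> p i + 1 + int l" for i
    using le_funD[OF p'(2), of i] le_funD[OF p'(3), of i] by auto
  let ?u = "sup (p' - (\<lambda>_. int l)) p" and ?v = "inf p' (p + (\<lambda>_. int l))"
  have "p \<le> ?v" "?v \<le> p + (\<lambda>_. int l)"
    using box by (auto simp: le_fun_def)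
  then have "?v \<notin> minimizers g"
    using mu_hat_le[of ?v g p l] l by (metis Suc_n_not_le_n)
  then have "g ?u < g p"
    using exchange_inf_minimizer[OF g p'(1) p, of l] by (meson not_le)
  moreover have "g (p + indicator X) \<le> g ?u"
  proof (rule arg_min_le_unit_box[OF X])
    fix i
    show "p i \<le> ?u i" "?u i \<le> p i + 1"
      using box[of i] by auto
  qed
  ultimately show ?thesis by (rule order.strict_trans1[rotated])
qed

text \<open>
  The first exchange makes the minimizer dominate \<open>p + indicator X\<close> without leaving the box of
  side \<open>l + 1\<close> above \<open>p\<close>. The second exchange then lowers exactly the coordinates outside \<open>X\<close>
  that are still at distance \<open>l + 1\<close> from \<open>p\<close>; coordinates in \<open>X\<close> are already close enough to
  \<open>p + indicator X\<close>.
\<close>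

lemma minimizer_above_steepest_step:
  fixes g :: "('n::finite \<Rightarrow> int) \<Rightarrow> ereal"
  assumes g: "ssq_Lnat_convex g" and q: "p + indicator X \<in> edom g"
    and p': "p' \<in> minimizers g" "p \<le> p'" "p' \<le> p + (\<lambda>_. int (Suc l))"
    and X: "is_arg_min (\<lambda>X. g (p + indicator X)) (\<lambda>_. True) X"
  obtains p'' where "p'' \<in> minimizers g" "p + indicator X \<le> p''"
    "p'' \<le> p + indicator X + (\<lambda>_. int l)"
proof -
  let ?q = "p + indicator X"
  have q_bounds: "p i \<le> ?q i" "?q i \<le> p i + 1" for i
    by (auto simp: indicator_def)
  have p'_bounds: "p i \<le> p' i" "p' i \<le> p i + 1 + int l" for i
    using le_funD[OF p'(2), of i] le_funD[OF p'(3), of i] by auto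
  define r where "r = sup p' ?q"
  have "g ?q \<le> g (inf p' (?q + (\<lambda>_. int 0)))"
  proof (rule arg_min_le_unit_box[OF X])
    fix i
    show "p i \<le> inf p' (?q + (\<lambda>_. int 0)) i" "inf p' (?q + (\<lambda>_. int 0)) i \<le> p i + 1"
      using q_bounds[of i] p'_bounds[of i] by (auto intro: le_infI2)
  qed
  then have r: "r \<in> minimizers g"
    using exchange_sup_minimizer[OF g p'(1) q, of 0] by (simp add: r_def zero_fun_def[symmetric])
  have r_bounds: "?q i \<le> r i" "r i \<le> p i + 1 + int l" for i
    using q_bounds[of i] p'_bounds[of i] by (auto simp: r_def indicator_def)
  have "g ?q \<le> g (sup (r - (\<lambda>_. int l)) ?q)"
  proof (rule arg_min_le_unit_box[OF X])
    fix i
    show "p i \<le> sup (r - (\<lambda>_. int l)) ?q i" "sup (r - (\<lambda>_. int l)) ?q i \<le> p i + 1"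
      using q_bounds[of i] r_bounds[of i] by (auto intro: le_supI2)
  qed
  then have "inf r (?q + (\<lambda>_. int l)) \<in> minimizers g"
    by (rule exchange_inf_minimizer[OF g r q])
  moreover have "?q \<le> inf r (?q + (\<lambda>_. int l))"
    using r_bounds by (auto simp: le_fun_def)
  moreover have "inf r (?q + (\<lambda>_. int l)) \<le> ?q + (\<lambda>_. int l)"
    by (rule inf_le2)
  ultimately show thesis by (rule that)
qed

lemma mu_hat_steepest_step:
  fixes g :: "('n::finite \<Rightarrow> int) \<Rightarrow> ereal"
  assumes g: "ssq_Lnat_convex g" and p: "p \<in> edom g" and lb: "\<exists>p'\<in>minimizers g. p \<le> p'"
    and nonmin: "p \<notin> minimizers g"
    and X: "is_arg_min (\<lambda>X. g (p + indicator X)) (\<lambda>_. True) X"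
  shows "p + indicator X \<in> edom g" "\<exists>p'\<in>minimizers g. p + indicator X \<le> p'"
    "mu_hat g p = Suc (mu_hat g (p + indicator X))"
proof -
  let ?q = "p + indicator X"
  show q: "?q \<in> edom g"
    using order.strict_trans[OF steepest_step_decreases[OF assms]] p unfolding edom_def by blast
  obtain l where l: "mu_hat g p = Suc l"
    using mu_hat_pos[OF lb nonmin] gr0_implies_Suc by blast
  obtain p' where p': "p' \<in> minimizers g" "p \<le> p'" "p' \<le> p + (\<lambda>_. int (Suc l))"
    using mu_hat_attained[OF lb] unfolding l .
  obtain p'' where p'': "p'' \<in> minimizers g" "?q \<le> p''" "p'' \<le> ?q + (\<lambda>_. int l)"
    using minimizer_above_steepest_step[OF g q p' X] .
  show lbq: "\<exists>p'\<in>minimizers g. ?q \<le> p'" using p'' by blast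
  have "mu_hat g ?q \<le> l" using mu_hat_le[OF p''] .
  moreover have "mu_hat g p \<le> Suc (mu_hat g ?q)"
  proof -
    obtain s where s: "s \<in> minimizers g" "?q \<le> s" "s \<le> ?q + (\<lambda>_. int (mu_hat g ?q))"
      using mu_hat_attained[OF lbq] .
    have "p i \<le> s i \<and> s i \<le> p i + int (Suc (mu_hat g ?q))" for i
      using le_funD[OF s(2), of i] le_funD[OF s(3), of i]
      by (cases "i \<in> X") auto
    then show ?thesis by (intro mu_hat_le[OF s(1)]) (auto simp: le_fun_def)
  qed
  ultimately show "mu_hat g p = Suc (mu_hat g ?q)" using l by simp
qed

lemma steepest_step_eq_iff_minimizer:
  fixes g :: "('n::finite \<Rightarrow> int) \<Rightarrow> ereal"
  assumes "ssq_Lnat_convex g" "p \<in> edom g" "\<exists>p'\<in>minimizers g. p \<le> p'"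
    and X: "is_arg_min (\<lambda>X. g (p + indicator X)) (\<lambda>_. True) X"
  shows "g (p + indicator X) = g p \<longleftrightarrow> p \<in> minimizers g"
proof
  assume "g (p + indicator X) = g p"
  then show "p \<in> minimizers g"
    using steepest_step_decreases[OF assms(1-3) _ X] by (metis less_irrefl)
next
  assume "p \<in> minimizers g"
  then have "g p \<le> g (p + indicator X)" by (rule minimizer_le)
  moreover have "g (p + indicator X) \<le> g p"
    by (rule arg_min_le_unit_box[OF X]) simp_all
  ultimately show "g (p + indicator X) = g p" by (rule order_antisym[rotated])
qed

section \<open>Runs of the algorithm\<close>

text \<open>
  The invariant of the run. In a running state the counter is the number of completed moves, so it
  complements \<open>mu_hat\<close>; the halting execution of Step 1 is counted in addition.
\<close>

fun sdu_inv :: "(('n::finite \<Rightarrow> int) \<Rightarrow> ereal) \<Rightarrow> nat \<Rightarrow> 'n sdu_state \<Rightarrow> bool" where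
  "sdu_inv g m (Running k p) \<longleftrightarrow>
    p \<in> edom g \<and> (\<exists>p'\<in>minimizers g. p \<le> p') \<and> k + mu_hat g p = m"
| "sdu_inv g m (Halted k p) \<longleftrightarrow> p \<in> minimizers g \<and> k = m + 1"

lemma sdu_step_inv:
  assumes g: "ssq_Lnat_convex g" and "sdu_step g s s'" "sdu_inv g m s"
  shows "sdu_inv g m s'"
  using assms(2,3)
proof cases
  case (stop p X k)
  then have "p \<in> minimizers g"
    using steepest_step_eq_iff_minimizer[OF g, of p X] assms(3) by auto
  then show ?thesis using stop assms(3) mu_hat_minimizer[of p g] by simp
next
  case (move p X k)
  then have p: "p \<in> edom g" "\<exists>p'\<in>minimizers g. p \<le> p'" using assms(3) by auto
  then have "p \<notin> minimizers g"
    using steepest_step_eq_iff_minimizer[OF g p] move by blast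
  then show ?thesis
    using mu_hat_steepest_step[OF g p _ move(3)] move assms(3) by simp
qed

lemma sdu_step_from_running:
  fixes g :: "('n::finite \<Rightarrow> int) \<Rightarrow> ereal"
  shows "\<exists>s'. sdu_step g (Running k p) s'"
proof -
  obtain X where "is_arg_min (\<lambda>X. g (p + indicator X)) (\<lambda>_. True) X"
    using ex_is_arg_min_if_finite[of "UNIV :: 'n set set" "\<lambda>X. g (p + indicator X)"]
    by auto
  then show ?thesis by (cases "g (p + indicator X) = g p") (auto intro: sdu_step.intros)
qed

text \<open>
  Only running states have successors, so in an infinite run the counter would exceed every bound,
  whereas the invariant keeps it at most \<open>m\<close>.
\<close>

lemma no_infinite_sdu_run:
  assumes g: "ssq_Lnat_convex g" and c0: "c 0 = Running 0 p0" "sdu_inv g m (c 0)"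
    and c: "\<And>i. sdu_step g (c i) (c (Suc i))"
  shows False
proof -
  have "\<exists>p. c i = Running i p \<and> sdu_inv g m (c i)" for i
  proof (induction i)
    case 0
    then show ?case using c0 by simp
  next
    case (Suc i)
    then obtain p where p: "c i = Running i p" "sdu_inv g m (c i)" by blast
    have "sdu_inv g m (c (Suc i))" by (rule sdu_step_inv[OF g c p(2)])
    moreover have "\<exists>p'. c (Suc i) = Running (Suc i) p'"
    proof -
      have "\<exists>k p'. c (Suc i) = Running k p'"
        using c[of "Suc i"] by (cases rule: sdu_step.cases) auto
      then show ?thesis using c[of i] p(1) by (auto elim: sdu_step.cases)
    qed
    ultimately show ?case by blast
  qed
  from this[of "Suc m"] show False by auto
qed

theorem theorem1p3:
  fixes g :: "('n::finite \<Rightarrow> int) \<Rightarrow> ereal" and p0 :: "'n \<Rightarrow> int"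
  assumes "\<forall>p. g p \<noteq> -\<infinity>"
    and "ssq_Lnat_convex g"
    and "p0 \<in> edom g"
    and "\<exists>p'\<in>minimizers g. p0 \<le> p'"
  shows "(\<nexists>c. c 0 = Running 0 p0 \<and> (\<forall>i::nat. sdu_step g (c i) (c (Suc i)))) \<and>
    (\<forall>s. (sdu_step g)\<^sup>*\<^sup>* (Running 0 p0) s \<and> (\<nexists>s'. sdu_step g s s') \<longrightarrow>
      (\<exists>p\<in>minimizers g. s = Halted (mu_hat g p0 + 1) p))"
proof (intro conjI allI impI)
  have init: "sdu_inv g (mu_hat g p0) (Running 0 p0)" using assms(3,4) by simp
  show "\<nexists>c. c 0 = Running 0 p0 \<and> (\<forall>i::nat. sdu_step g (c i) (c (Suc i)))"
    using no_infinite_sdu_run[OF assms(2)] init by metis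
  fix s assume s: "(sdu_step g)\<^sup>*\<^sup>* (Running 0 p0) s \<and> (\<nexists>s'. sdu_step g s s')"
  then have "(sdu_step g)\<^sup>*\<^sup>* (Running 0 p0) s" by blast
  then have "sdu_inv g (mu_hat g p0) s"
    by (induction rule: rtranclp_induct) (auto simp: init intro: sdu_step_inv[OF assms(2)]
      simp del: sdu_inv.simps)
  moreover have "\<exists>k p. s = Halted k p"
    using s sdu_step_from_running[of g] by (cases s) auto
  ultimately show "\<exists>p\<in>minimizers g. s = Halted (mu_hat g p0 + 1) p" by auto
qed

end
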